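(* Let $f(z)=\sum_{k\ge0}a_kz^k$ be an analytic function on (a neighbourhood of) $D_1$ with $f(0)=0$ and $|f|\le1$ on $D_1$, such that for each $d\ge 1$ the Bautin determinant $\Delta_d(z)$ does not vanish identically as a function of $z$. Assume that the Taylor coefficients $a_k$ of $f$ at the origin are rational, that there exists a polynomial $S$ with positive coefficients such that $h_l\le e^{S(l)}$ for all $l\ge1$, and that there exists a polynomial $R$ such that $\eta_d\le R(d)$ for all $d\ge1$. Then there exists a polynomial $T$ such that $\mathcal{Z}_d(f)\le T(d)$ for all $d\ge1$, where $\mathcal{Z}_d(f)$ counts zeroes in the disc $D_{1/4}$.
   Context: $D_r=\{z\in\mathbb{C}:|z|\le r\}$. Write $a_k=m_k/p_k$ with $m_k\in\mathbb{Z}$, $p_k\in\mathbb{Z}_{>0}$ coprime; for $l\ge1$ put $h_l=\max\{p_k: k=1,\dots,l\}$. For $z$ near $0$ put $a_i^j(z)=\frac{1}{i!}(f^j)^{(i)}(z)$, the $i$-th Taylor coefficient of $f^j$ at the point $z$. For $d\ge1$ the Bautin determinant $\Delta_d(z)$ is the determinant of the $(d^2+d)\times(d^2+d)$ matrix whose rows are indexed by $k=d+1,\dots,d^2+2d$, whose columns are indexed by pairs $(j,i)$ with $1\le j\le d$, $0\le i\le d$ (ordered lexicographically), and whose entry in row $k$ and column $(j,i)$ is $a^j_{k-i}(z)$. The $d$-th Bautin multiplicity $\eta_d$ of $f$ is the order of vanishing of $\Delta_d(z)$ at $z=0$, i.e. $\Delta_d(z)=\alpha_dz^{\eta_d}+O(z^{\eta_d+1})$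 with $\alpha_d\neq0$. $\mathcal{Z}_d(f)$ is the maximum, over all $(p_0,\dots,p_d)\ne(0,\dots,0)$ with $p_j\in\mathbb{C}[z]$, $\deg p_j\le d$, of the number of zeroes (with multiplicity) in $D_{1/4}$ of $\sum_{j=0}^dp_j(z)f(z)^j$. *)

theory Defs
  imports
    "HOL-Complex_Analysis.Complex_Analysis"
    "HOL-Library.Extended_Real"
    "HOL-Computational_Algebra.Polynomial"
    "Jordan_Normal_Form.Determinant"
begin

definition taylor_coeff :: "(complex \<Rightarrow> complex) \<Rightarrow> nat \<Rightarrow> complex \<Rightarrow> complex" where
  "taylor_coeff f k z = (deriv ^^ k) f z / fact k"

definition denom_height :: "(nat \<Rightarrow> int) \<Rightarrow> nat \<Rightarrow> int" where
  "denom_height p l = Max (p ` {1..l})"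

text \<open>Counting from 0, matrix row \<open>r\<close> stands for \<open>k = d + 1 + r\<close>, and matrix column \<open>c\<close> for the
  pair \<open>(j, i) = (c div (d + 1) + 1, c mod (d + 1))\<close>, which enumerates \<open>{1..d} \<times> {0..d}\<close>
  lexicographically. Always \<open>i \<le> d < k\<close>, so the subtraction \<open>k - i\<close> does not truncate.\<close>
definition bautin_matrix :: "(complex \<Rightarrow> complex) \<Rightarrow> nat \<Rightarrow> complex \<Rightarrow> complex Matrix.mat" where
  "bautin_matrix f d z =
     Matrix.mat (d^2 + d) (d^2 + d) (\<lambda>(r, c).
       let k = d + 1 + r; j = c div (d + 1) + 1; i = c mod (d + 1)
       in taylor_coeff (\<lambda>w. f w ^ j) (k - i) z)"

definition bautin_det :: "(complex \<Rightarrow> complex) \<Rightarrow> nat \<Rightarrow> complex \<Rightarrow> complex" where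
  "bautin_det f d z = Determinant.det (bautin_matrix f d z)"

text \<open>Meaningful only if the determinant does not vanish identically near 0.\<close>
definition bautin_multiplicity :: "(complex \<Rightarrow> complex) \<Rightarrow> nat \<Rightarrow> int" where
  "bautin_multiplicity f d = zorder (bautin_det f d) 0"

text \<open>If \<open>F\<close> is analytic on \<open>A\<close>, then \<open>zorder F z\<close> is the multiplicity of \<open>z\<close> as a zero
  whenever \<open>z\<close> is an isolated zero. An infinite zero set, in particular that of
  \<open>F = 0\<close> on a disc, counts as \<open>\<infinity>\<close>.\<close>
definition zero_count :: "(complex \<Rightarrow> complex) \<Rightarrow> complex set \<Rightarrow> enat" where
  "zero_count F A =
     (if finite {z \<in> A. F z = 0}
      then enat (\<Sum>z \<in> {z \<in> A. F z = 0}. nat (zorder F z))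
      else \<infinity>)"

definition poly_tuples :: "nat \<Rightarrow> (nat \<Rightarrow> complex poly) set" where
  "poly_tuples d = {P. (\<forall>j\<le>d. degree (P j) \<le> d) \<and> (\<exists>j\<le>d. P j \<noteq> 0)}"

text \<open>The supremum is taken in \<^typ>\<open>enat\<close>, so it is the maximum as soon as it is finite,
  and an upper bound on it does bound every zero count.\<close>
definition max_zeros :: "(complex \<Rightarrow> complex) \<Rightarrow> nat \<Rightarrow> enat" where
  "max_zeros f d =
     (SUP P \<in> poly_tuples d.
        zero_count (\<lambda>z. \<Sum>j\<le>d. poly (P j) z * f z ^ j) (cball 0 (1/4)))"

end

theory Submission imports Defs
begin

text \<open>Put \<open>N = d\<^sup>2 + 2 d + \<eta>\<^sub>d\<close>. By Cramer's rule for the Bautin matrix, a combination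
  \<open>F = \<Sum>j\<le>d. p\<^sub>j f^j\<close> is determined by its Taylor coefficients at 0 up to index \<open>N\<close>. The matrix of
  this linear map is rational with denominators at most exponential in a polynomial of \<open>d\<close>, so its
  Gram determinant is bounded below, and some Taylor coefficient of index at most \<open>N\<close> is at least
  \<open>exp (- poly d)\<close> times the largest coefficient of the \<open>p\<^sub>j\<close>. On the other hand, \<open>n\<close> zeros in the disc
  of radius 1/4 force that coefficient to be at most \<open>(2/3)^n 4^N\<close> times the maximum of \<open>F\<close> on the unit
  circle.\<close>

subsection \<open>Determinants and Cramer's rule\<close>

lemma norm_det_le:
  fixes A :: "complex Matrix.mat"
  assumes A: "A \<in> carrier_mat n n"
    and K: "\<And>i j. i < n \<Longrightarrow> j < n \<Longrightarrow> norm (A $$ (i,j)) \<le> K"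
  shows "norm (Determinant.det A) \<le> fact n * K ^ n"
proof -
  have "norm (Determinant.det A) \<le>
      (\<Sum>p | p permutes {0..<n}. norm (signof p * (\<Prod>i = 0..<n. A $$ (i, p i)) :: complex))"
    unfolding det_def'[OF A] by (rule norm_sum)
  also have "\<dots> \<le> (\<Sum>p | p permutes {0..<n}. K ^ n)"
  proof (intro sum_mono)
    fix p assume p: "p \<in> {p. p permutes {0..<n}}"
    have "norm (signof p :: complex) = 1" by (simp add: sign_def)
    moreover have "(\<Prod>i = 0..<n. norm (A $$ (i, p i))) \<le> (\<Prod>i = 0..<n. K)"
      by (intro prod_mono) (use p K in \<open>auto dest: permutes_in_image\<close>)
    ultimately show "norm (signof p * (\<Prod>i = 0..<n. A $$ (i, p i)) :: complex) \<le> K ^ n"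
      by (simp add: norm_mult prod_norm)
  qed
  also have "\<dots> = fact n * K ^ n"
    by (simp add: card_permutations)
  finally show ?thesis .
qed

lemma det_in_Ints:
  fixes A :: "complex Matrix.mat"
  assumes A: "A \<in> carrier_mat n n" and "\<And>i j. i < n \<Longrightarrow> j < n \<Longrightarrow> A $$ (i,j) \<in> \<int>"
  shows "Determinant.det A \<in> \<int>"
  unfolding det_def'[OF A]
  by (intro Ints_sum Ints_mult Ints_prod) (auto simp: sign_def assms dest: permutes_in_image)

lemma det_analytic_on:
  fixes M :: "complex \<Rightarrow> complex Matrix.mat"
  assumes M: "\<And>z. M z \<in> carrier_mat n n"
    and an: "\<And>i j. i < n \<Longrightarrow> j < n \<Longrightarrow> (\<lambda>z. M z $$ (i,j)) analytic_on S"
  shows "(\<lambda>z. Determinant.det (M z)) analytic_on S"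
  unfolding det_def'[OF M]
  by (intro analytic_on_sum analytic_on_mult analytic_on_prod analytic_on_const an)
     (auto dest: permutes_in_image)

text \<open>Apply \<open>adj_mat A * A = det A * 1\<close> to the vector \<open>v\<close>. This
  division-free form of Cramer's rule stays meaningful where the determinant vanishes, as the Bautin
  determinant may at 0.\<close>

lemma det_mult_eq_cofactor_sum:
  fixes A :: "'a :: comm_ring_1 Matrix.mat"
  assumes A: "A \<in> carrier_mat n n" and s: "s < n"
  shows "Determinant.det A * v s = (\<Sum>r<n. cofactor A r s * (\<Sum>t<n. A $$ (r,t) * v t))"
proof -
  have "(\<Sum>r<n. cofactor A r s * (\<Sum>t<n. A $$ (r,t) * v t))
      = (\<Sum>t<n. (\<Sum>r<n. cofactor A r s * A $$ (r,t)) * v t)"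
    by (subst sum_distrib_left, subst sum.swap) (simp add: sum_distrib_right mult.assoc)
  also have "\<dots> = (\<Sum>t<n. (if t = s then Determinant.det A else 0) * v t)"
  proof (intro sum.cong refl)
    fix t assume t: "t \<in> {..<n}"
    have "(adj_mat A * A) $$ (s,t) = (\<Sum>r<n. cofactor A r s * A $$ (r,t))"
      using A s t adj_mat(1)[OF A]
      by (auto simp: scalar_prod_def adj_mat_def atLeast0LessThan intro!: sum.cong)
    then show "(\<Sum>r<n. cofactor A r s * A $$ (r,t)) * v t =
        (if t = s then Determinant.det A else 0) * v t"
      using adj_mat(3)[OF A] s t by auto
  qed
  also have "\<dots> = Determinant.det A * v s"
    using s by (simp add: if_distrib[of "\<lambda>x. x * _"] cong: if_cong)
  finally show ?thesis ..
qed

lemma norm_cofactor_le: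
  fixes A :: "complex Matrix.mat"
  assumes A: "A \<in> carrier_mat n n"
    and K: "\<And>i j. i < n \<Longrightarrow> j < n \<Longrightarrow> norm (A $$ (i,j)) \<le> K"
    and rs: "r < n" "s < n"
  shows "norm (cofactor A r s) \<le> fact (n - 1) * K ^ (n - 1)"
proof -
  have "norm (Determinant.det (mat_delete A r s)) \<le> fact (n - 1) * K ^ (n - 1)"
  proof (rule norm_det_le)
    fix i j assume "i < n - 1" "j < n - 1"
    then show "norm (mat_delete A r s $$ (i,j)) \<le> K"
      using A by (auto simp: mat_delete_def intro!: K)
  qed (rule mat_delete_carrier[OF A])
  then show ?thesis
    by (simp add: cofactor_def norm_mult norm_power)
qed

text \<open>The Gram matrix of \<open>a\<close> is nonsingular, and after clearing denominators its determinant is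
  a nonzero integer; Cramer's rule then bounds \<open>v\<close> in terms of \<open>a v\<close>.\<close>
lemma injective_system_lower_bound:
  fixes a :: "nat \<Rightarrow> nat \<Rightarrow> complex" and B :: real
  assumes int: "\<And>k s. k < m \<Longrightarrow> s < n \<Longrightarrow> of_real B * a k s \<in> \<int>"
    and B: "B > 0"
    and bnd: "\<And>k s. k < m \<Longrightarrow> s < n \<Longrightarrow> norm (a k s) \<le> 1"
    and inj: "\<And>v. (\<And>k. k < m \<Longrightarrow> (\<Sum>s<n. a k s * v s) = 0) \<Longrightarrow> (\<forall>s<n. v s = 0)"
    and s: "s < n"
    and e: "\<And>k. k < m \<Longrightarrow> norm (\<Sum>s<n. a k s * v s) \<le> e"
  shows "norm (v s) \<le> B ^ (2 * n) * (fact n * real m ^ n) * e"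
proof -
  have real: "a k s \<in> \<real>" if "k < m" "s < n" for k s
  proof -
    have "of_real B * a k s \<in> \<real>" using int[OF that] by (auto elim!: Ints_cases)
    then have "of_real B * a k s / of_real B \<in> \<real>" by (intro Reals_divide) auto
    then show ?thesis using B by simp
  qed
  \<comment> \<open>No conjugation is written: the entries of \<open>a\<close> are real, so
    \<open>M\<close> is a Gram matrix whose entries are still sums of products of numbers that
    \<open>B\<close> makes integral.\<close>
  define M where "M = Matrix.mat n n (\<lambda>(i,j). \<Sum>k<m. a k i * a k j)"
  have M: "M \<in> carrier_mat n n" by (simp add: M_def)
  have Mij: "M $$ (i,j) = (\<Sum>k<m. a k i * a k j)" if "i < n" "j < n" for i j
    using that by (simp add: M_def)
  have Mv: "(\<Sum>t<n. M $$ (r,t) * u t) = (\<Sum>k<m. a k r * (\<Sum>t<n. a k t * u t))" if "r < n" for r u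
  proof -
    have "(\<Sum>t<n. M $$ (r,t) * u t) = (\<Sum>t<n. (\<Sum>k<m. a k r * a k t) * u t)"
      using that by (simp add: Mij)
    also have "\<dots> = (\<Sum>k<m. a k r * (\<Sum>t<n. a k t * u t))"
      by (subst sum_distrib_left, subst sum.swap) (simp add: sum_distrib_right mult.assoc)
    finally show ?thesis .
  qed
  have detnz: "Determinant.det M \<noteq> 0"
  proof
    assume "Determinant.det M = 0"
    then obtain w where w: "w \<in> carrier_vec n" "w \<noteq> 0\<^sub>v n" "M *\<^sub>v w = 0\<^sub>v n"
      using det_0_iff_vec_prod_zero_field[OF M] by blast
    define u where "u = vec_index w"
    have Mu: "(\<Sum>t<n. M $$ (r,t) * u t) = 0" if "r < n" for r
    proof -
      have "(\<Sum>t<n. M $$ (r,t) * u t) = vec_index (M *\<^sub>v w) r"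
        using M w(1) that by (auto simp: scalar_prod_def u_def atLeast0LessThan intro!: sum.cong)
      then show ?thesis using w(3) that by simp
    qed
    \<comment> \<open>Pairing \<open>M u\<close> with the conjugate of \<open>u\<close> yields the
      sum of the squared norms of the entries of \<open>a u\<close>, so a kernel vector of
      \<open>M\<close> is a kernel vector of \<open>a\<close>.\<close>
    have "cnj (u r) * (\<Sum>t<n. M $$ (r,t) * u t) =
        (\<Sum>k<m. cnj (a k r * u r) * (\<Sum>t<n. a k t * u t))" if r: "r < n" for r
      unfolding Mv[OF r]
    proof (subst sum_distrib_left, intro sum.cong refl)
      fix k assume "k \<in> {..<m}"
      then have "cnj (a k r) = a k r" using real r by (simp add: Reals_cnj_iff)
      then show "cnj (u r) * (a k r * (\<Sum>t<n. a k t * u t)) =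
          cnj (a k r * u r) * (\<Sum>t<n. a k t * u t)" by simp
    qed
    then have "(\<Sum>r<n. cnj (u r) * (\<Sum>t<n. M $$ (r,t) * u t)) =
        (\<Sum>r<n. \<Sum>k<m. cnj (a k r * u r) * (\<Sum>t<n. a k t * u t))"
      by simp
    also have "\<dots> = (\<Sum>k<m. cnj (\<Sum>t<n. a k t * u t) * (\<Sum>t<n. a k t * u t))"
      by (subst sum.swap) (simp add: sum_distrib_right)
    also have "\<dots> = of_real (\<Sum>k<m. (norm (\<Sum>t<n. a k t * u t))\<^sup>2)"
      by (simp add: complex_norm_square mult.commute del: of_real_power)
    finally have "(\<Sum>k<m. (norm (\<Sum>t<n. a k t * u t))\<^sup>2) = 0"
      using Mu by (metis (no_types, lifting) lessThan_iff mult_zero_right of_real_eq_0_iff sum.neutral)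
    then have "(\<Sum>t<n. a k t * u t) = 0" if "k < m" for k
      using that by (subst (asm) sum_nonneg_eq_0_iff) auto
    then have "\<forall>s<n. u s = 0" by (rule inj)
    then show False using w(1,2) unfolding u_def by auto
  qed
  have MK: "norm (M $$ (i,j)) \<le> real m" if "i < n" "j < n" for i j
  proof -
    have "norm (M $$ (i,j)) \<le> (\<Sum>k<m. norm (a k i * a k j))"
      unfolding Mij[OF that] by (rule norm_sum)
    also have "\<dots> \<le> (\<Sum>k<m. 1)"
      by (intro sum_mono) (use bnd that in \<open>auto simp: norm_mult intro!: mult_le_one\<close>)
    finally show ?thesis by simp
  qed
  \<comment> \<open>Entries of \<open>M\<close> are quadratic in \<open>a\<close>, so
    \<open>B^2\<close> clears each of them and \<open>B^(2n)\<close> clears the determinant. A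
    nonzero integer has norm at least 1.\<close>
  have "of_real (B\<^sup>2) ^ n * Determinant.det M = Determinant.det (of_real (B\<^sup>2) \<cdot>\<^sub>m M)"
    using M by simp
  also have "\<dots> \<in> \<int>"
  proof (rule det_in_Ints)
    fix i j assume ij: "i < n" "j < n"
    have "(of_real (B\<^sup>2) \<cdot>\<^sub>m M) $$ (i,j) = (\<Sum>k<m. (of_real B * a k i) * (of_real B * a k j))"
      using M ij by (simp add: Mij sum_distrib_left power2_eq_square mult_ac)
    also have "\<dots> \<in> \<int>" by (rule Ints_sum, rule Ints_mult) (use int ij in auto)
    finally show "(of_real (B\<^sup>2) \<cdot>\<^sub>m M) $$ (i,j) \<in> \<int>" .
  qed (use M in auto)
  finally obtain q where q: "of_real (B\<^sup>2) ^ n * Determinant.det M = of_int q"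
    by (elim Ints_cases)
  have "q \<noteq> 0" using q detnz B by auto
  then have "1 \<le> norm (of_int q :: complex)" by simp
  also have "\<dots> = B ^ (2*n) * norm (Determinant.det M)"
    using B by (simp flip: q add: norm_mult norm_power power_mult)
  finally have one: "1 \<le> B ^ (2*n) * norm (Determinant.det M)" .
  have e0: "e \<ge> 0 \<or> m = 0" using e norm_ge_zero order_trans by blast
  \<comment> \<open>Cramer's rule for the normal equations: the right-hand side is the transpose of
    \<open>a\<close> applied to \<open>a v\<close>, with entries of norm at most
    \<open>m * e\<close>.\<close>
  have "norm (Determinant.det M) * norm (v s) =
      norm (\<Sum>r<n. cofactor M r s * (\<Sum>k<m. a k r * (\<Sum>t<n. a k t * v t)))"
    unfolding norm_mult[symmetric] det_mult_eq_cofactor_sum[OF M s] by (simp add: Mv)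
  also have "\<dots> \<le> (\<Sum>r<n. (fact (n-1) * real m ^ (n-1)) * (real m * e))"
  proof (intro sum_norm_le)
    fix r assume r: "r \<in> {..<n}"
    have "norm (\<Sum>k<m. a k r * (\<Sum>t<n. a k t * v t)) \<le> (\<Sum>k<m. 1 * e)"
    proof (rule sum_norm_le)
      fix k assume "k \<in> {..<m}"
      then show "norm (a k r * (\<Sum>t<n. a k t * v t)) \<le> 1 * e"
        unfolding norm_mult using bnd e r by (intro mult_mono) auto
    qed
    then show "norm (cofactor M r s * (\<Sum>k<m. a k r * (\<Sum>t<n. a k t * v t)))
        \<le> (fact (n-1) * real m ^ (n-1)) * (real m * e)"
      unfolding norm_mult using r s
      by (intro mult_mono norm_cofactor_le[OF M MK]) auto
  qed
  also have "\<dots> = fact n * real m ^ n * e"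
    using s by (cases n) (simp_all add: algebra_simps)
  finally have le: "norm (Determinant.det M) * norm (v s) \<le> fact n * real m ^ n * e" .
  have "norm (v s) \<le> (B ^ (2*n) * norm (Determinant.det M)) * norm (v s)"
    using one by (simp add: mult_le_cancel_right1)
  also have "\<dots> \<le> B ^ (2*n) * (fact n * real m ^ n * e)"
    using le B by (simp add: mult.assoc mult_left_mono)
  finally show ?thesis by (simp add: mult.assoc)
qed

subsection \<open>Taylor coefficients and the Bautin matrix\<close>

lemma taylor_coeff_eq_fps_nth: "taylor_coeff f k z = fps_nth (fps_expansion f z) k"
  by (simp add: taylor_coeff_def fps_expansion_def)

lemma taylor_coeff_cong_ev:
  "\<forall>\<^sub>F w in nhds z. f w = g w \<Longrightarrow> taylor_coeff f k z = taylor_coeff g k z"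
  unfolding taylor_coeff_eq_fps_nth by (simp cong: fps_expansion_cong)

lemma taylor_coeff_mult:
  assumes "f analytic_on {z}" "g analytic_on {z}"
  shows "taylor_coeff (\<lambda>w. f w * g w) k z =
    (\<Sum>i\<le>k. taylor_coeff f i z * taylor_coeff g (k - i) z)"
  unfolding taylor_coeff_def higher_deriv_mult_at[OF assms] sum_divide_distrib
  by (intro sum.cong) (auto simp: binomial_fact field_simps)

lemma taylor_coeff_sum:
  assumes "\<And>i. i \<in> I \<Longrightarrow> f i analytic_on {z}"
  shows "taylor_coeff (\<lambda>w. \<Sum>i\<in>I. f i w) k z = (\<Sum>i\<in>I. taylor_coeff (f i) k z)"
  using assms
proof (induction I rule: infinite_finite_induct)
  case (insert i I)
  have "taylor_coeff (\<lambda>w. f i w + (\<Sum>i\<in>I. f i w)) k z =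
      taylor_coeff (f i) k z + taylor_coeff (\<lambda>w. \<Sum>i\<in>I. f i w) k z"
    unfolding taylor_coeff_def
    by (subst higher_deriv_add_at) (use insert.prems in \<open>auto intro!: analytic_intros simp: add_divide_distrib\<close>)
  with insert show ?case by simp
qed (auto simp: taylor_coeff_def)

lemma taylor_coeff_const: "taylor_coeff (\<lambda>_. c) k z = (if k = 0 then c else 0)"
  by (simp add: taylor_coeff_def)

lemma higher_deriv_poly: "(deriv ^^ k) (poly p) = poly ((pderiv ^^ k) p)" for p :: "complex poly"
proof (induction k)
  case (Suc k)
  have "deriv (poly q) = poly (pderiv q)" for q :: "complex poly"
    by (intro ext DERIV_imp_deriv poly_DERIV)
  with Suc show ?case by simp
qed simp

lemma taylor_coeff_poly_0: "taylor_coeff (poly p) k 0 = Polynomial.coeff p k"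
  by (simp add: taylor_coeff_def higher_deriv_poly poly_0_coeff_0 coeff_higher_pderiv
        pochhammer_fact[symmetric] fact_nonzero)

lemma taylor_coeff_poly_eq_0:
  assumes "Polynomial.degree p < k"
  shows "taylor_coeff (poly p) k z = 0"
proof -
  have "(pderiv ^^ k) p = 0"
    by (rule poly_eqI) (use assms in \<open>simp add: coeff_higher_pderiv coeff_eq_0\<close>)
  then show ?thesis by (simp add: taylor_coeff_def higher_deriv_poly)
qed

lemma analytic_on_poly: "poly p analytic_on S" for p :: "complex poly"
  by (meson analytic_on_subset analytic_on_open field_differentiable_def holomorphic_onI
        has_field_derivative_at_within open_UNIV poly_DERIV subset_UNIV)

lemma analytic_on_taylor_coeff:
  "f analytic_on S \<Longrightarrow> taylor_coeff f k analytic_on S"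
  unfolding taylor_coeff_def by (intro analytic_intros) auto

text \<open>Both sides involve the derivative of order \<open>l + k\<close> at \<open>z\<close>,
  divided by different factorials. This carries vanishing of \<open>f\<close> at a fixed point over
  to its coefficients taken as functions of the centre.\<close>

lemma taylor_coeff_of_taylor_coeff_eq_0:
  assumes "f analytic_on {z}" "taylor_coeff f (l + k) z = 0"
  shows "taylor_coeff (taylor_coeff f k) l z = 0"
proof -
  have "taylor_coeff (\<lambda>w. inverse (fact k) * (deriv ^^ k) f w) l z = 0"
    using assms(2)
    by (subst taylor_coeff_mult)
       (auto intro!: analytic_intros assms(1) sum.neutral
          simp: taylor_coeff_const, auto simp: taylor_coeff_def funpow_add)
  then show ?thesis
    by (simp add: taylor_coeff_def[abs_def] divide_inverse mult.commute)
qed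

text \<open>The witness \<open>n\<close> is the subdegree of the Taylor expansion, which is nonzero
  because \<open>f\<close> does not vanish identically near \<open>z\<close>.\<close>

lemma zorder_taylor_coeff:
  assumes "f analytic_on {z}" "\<not> (\<forall>\<^sub>F w in nhds z. f w = 0)"
  obtains n where "zorder f z = int n" "taylor_coeff f n z \<noteq> 0"
    "\<And>i. i < n \<Longrightarrow> taylor_coeff f i z = 0"
proof -
  let ?F = "fps_expansion f z"
  have F: "(\<lambda>w. f (z + w)) has_fps_expansion ?F"
    by (rule analytic_at_imp_has_fps_expansion[OF assms(1)])
  have nz: "?F \<noteq> 0"
  proof
    assume "?F = 0"
    then have "\<forall>\<^sub>F w in nhds z. f w = 0"
      using F by (auto simp: has_fps_expansion_0_iff nhds_to_0' eventually_filtermap)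
    with assms(2) show False by contradiction
  qed
  show thesis
    by (rule that[of "subdegree ?F"])
       (use nz has_fps_expansion_zorder[OF F nz] in \<open>auto simp: taylor_coeff_eq_fps_nth\<close>)
qed

text \<open>Cut the range into consecutive blocks of length \<open>n\<close>. This decodes the
  column index into the pair (j, i), with \<open>d\<close> blocks for the Bautin matrix and
  \<open>d + 1\<close> for the full system.\<close>

lemma sum_div_mod:
  fixes g :: "nat \<Rightarrow> nat \<Rightarrow> 'a :: comm_monoid_add"
  shows "(\<Sum>c<m*n. g (c div n) (c mod n)) = (\<Sum>j<m. \<Sum>i<n. g j i)"
proof -
  have "(\<Sum>c<m*n. g (c div n) (c mod n)) = (\<Sum>j<m. \<Sum>c=j*n..<j*n+n. g (c div n) (c mod n))"
    by (rule sum.nat_group[symmetric])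
  also have "\<dots> = (\<Sum>j<m. \<Sum>i<n. g j i)"
  proof (rule sum.cong[OF refl])
    fix j
    have "(\<Sum>c=j*n..<j*n+n. g (c div n) (c mod n)) = (\<Sum>i=0..<n. g ((i+j*n) div n) ((i+j*n) mod n))"
      using sum.shift_bounds_nat_ivl[of "\<lambda>c. g (c div n) (c mod n)" 0 "j*n" n]
      by (simp add: add.commute)
    then show "(\<Sum>c=j*n..<j*n+n. g (c div n) (c mod n)) = (\<Sum>i<n. g j i)"
      by (simp add: atLeast0LessThan)
  qed
  finally show ?thesis .
qed

section \<open>The Bautin matrix: analyticity and action on coefficient vectors\<close>

lemma bautin_matrix_carrier: "bautin_matrix f d z \<in> carrier_mat (d\<^sup>2 + d) (d\<^sup>2 + d)"
  by (simp add: bautin_matrix_def)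

lemma bautin_matrix_analytic:
  assumes "f analytic_on S" "r < d\<^sup>2 + d" "c < d\<^sup>2 + d"
  shows "(\<lambda>z. bautin_matrix f d z $$ (r,c)) analytic_on S"
  using assms by (auto simp: bautin_matrix_def Let_def intro!: analytic_on_taylor_coeff analytic_intros)

lemma bautin_det_analytic: "f analytic_on S \<Longrightarrow> bautin_det f d analytic_on S"
  unfolding bautin_det_def[abs_def]
  by (rule det_analytic_on[OF bautin_matrix_carrier]) (rule bautin_matrix_analytic)

lemma bautin_cofactor_analytic:
  assumes "f analytic_on S" "r < d\<^sup>2 + d" "s < d\<^sup>2 + d"
  shows "(\<lambda>z. cofactor (bautin_matrix f d z) r s) analytic_on S"
  unfolding cofactor_def
proof (intro analytic_on_mult analytic_on_const)
  show "(\<lambda>z. Determinant.det (mat_delete (bautin_matrix f d z) r s)) analytic_on S"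
  proof (rule det_analytic_on[OF mat_delete_carrier[OF bautin_matrix_carrier]])
    fix i j assume ij: "i < d\<^sup>2 + d - 1" "j < d\<^sup>2 + d - 1"
    have "(\<lambda>z. mat_delete (bautin_matrix f d z) r s $$ (i,j)) =
      (\<lambda>z. bautin_matrix f d z $$ (if i < r then i else Suc i, if j < s then j else Suc j))"
      using ij bautin_matrix_carrier by (simp add: mat_delete_def fun_eq_iff carrier_matD[OF bautin_matrix_carrier])
    then show "(\<lambda>z. mat_delete (bautin_matrix f d z) r s $$ (i,j)) analytic_on S"
      using bautin_matrix_analytic[OF assms(1)] ij by simp
  qed
qed

text \<open>Leibniz' rule, cut off at \<open>d\<close> by the degree bound. The test
  \<open>i \<le> k\<close> guards against truncated subtraction in \<open>k - i\<close>. The centre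
  is kept general so that identities can later be expanded in \<open>z\<close>.\<close>

lemma taylor_coeff_poly_tuple:
  fixes P :: "nat \<Rightarrow> complex poly"
  assumes f: "f analytic_on {z}" and deg: "\<And>j. j \<le> d \<Longrightarrow> Polynomial.degree (P j) \<le> d"
  shows "taylor_coeff (\<lambda>w. \<Sum>j\<le>d. poly (P j) w * f w ^ j) k z =
    (\<Sum>j\<le>d. \<Sum>i\<le>d. (if i \<le> k then taylor_coeff (\<lambda>w. f w ^ j) (k - i) z else 0) *
       taylor_coeff (poly (P j)) i z)"
proof -
  have "taylor_coeff (\<lambda>w. \<Sum>j\<le>d. poly (P j) w * f w ^ j) k z =
      (\<Sum>j\<le>d. taylor_coeff (\<lambda>w. poly (P j) w * f w ^ j) k z)"
    by (intro taylor_coeff_sum analytic_intros analytic_on_poly f)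
  also have "\<dots> = (\<Sum>j\<le>d. \<Sum>i\<le>d. (if i \<le> k then taylor_coeff (\<lambda>w. f w ^ j) (k - i) z else 0) *
       taylor_coeff (poly (P j)) i z)"
  proof (intro sum.cong refl)
    fix j assume j: "j \<in> {..d}"
    have "taylor_coeff (\<lambda>w. poly (P j) w * f w ^ j) k z =
        (\<Sum>i\<le>k. taylor_coeff (poly (P j)) i z * taylor_coeff (\<lambda>w. f w ^ j) (k - i) z)"
      by (intro taylor_coeff_mult analytic_intros analytic_on_poly f)
    also have "\<dots> = (\<Sum>i\<in>{..k} \<inter> {..d}.
         taylor_coeff (poly (P j)) i z * taylor_coeff (\<lambda>w. f w ^ j) (k - i) z)"
    proof (rule sum.mono_neutral_right)
      show "\<forall>i\<in>{..k} - {..k} \<inter> {..d}.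
          taylor_coeff (poly (P j)) i z * taylor_coeff (\<lambda>w. f w ^ j) (k - i) z = 0"
        using deg[of j] j by (auto intro!: taylor_coeff_poly_eq_0)
    qed auto
    also have "\<dots> = (\<Sum>i\<le>d. (if i \<le> k then taylor_coeff (\<lambda>w. f w ^ j) (k - i) z else 0) *
       taylor_coeff (poly (P j)) i z)"
      by (intro sum.mono_neutral_cong_left) auto
    finally show "taylor_coeff (\<lambda>w. poly (P j) w * f w ^ j) k z = \<dots>" .
  qed
  finally show ?thesis .
qed

text \<open>The column \<open>j = 0\<close> is absent from the Bautin matrix because \<open>P 0\<close> has no Taylor coefficients
  of index above \<open>d\<close>.\<close>
lemma bautin_matrix_mult:
  fixes P :: "nat \<Rightarrow> complex poly"
  assumes f: "f analytic_on {z}" and deg: "\<And>j. j \<le> d \<Longrightarrow> Polynomial.degree (P j) \<le> d"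
    and r: "r < d\<^sup>2 + d"
  shows "(\<Sum>c<d\<^sup>2+d. bautin_matrix f d z $$ (r,c) *
            taylor_coeff (poly (P (c div (d+1) + 1))) (c mod (d+1)) z) =
         taylor_coeff (\<lambda>w. \<Sum>j\<le>d. poly (P j) w * f w ^ j) (d + 1 + r) z"
proof -
  let ?k = "d + 1 + r"
  let ?g = "\<lambda>j i. taylor_coeff (\<lambda>w. f w ^ j) (?k - i) z * taylor_coeff (poly (P j)) i z"
  have dd: "d\<^sup>2 + d = d * (d + 1)" by (simp add: power2_eq_square)
  have "(\<Sum>c<d\<^sup>2+d. bautin_matrix f d z $$ (r,c) *
            taylor_coeff (poly (P (c div (d+1) + 1))) (c mod (d+1)) z) =
       (\<Sum>c<d * (d+1). ?g (c div (d+1) + 1) (c mod (d+1)))"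
    unfolding dd by (intro sum.cong refl) (use r in \<open>simp add: bautin_matrix_def Let_def dd\<close>)
  also have "\<dots> = (\<Sum>j<d. \<Sum>i<d+1. ?g (j + 1) i)"
    by (rule sum_div_mod)
  also have "\<dots> = (\<Sum>j<d. \<Sum>i\<le>d. ?g (Suc j) i)"
    by (simp only: Suc_eq_plus1[symmetric] lessThan_Suc_atMost)
  \<comment> \<open>For \<open>j = 0\<close> the power of \<open>f\<close> is the constant 1, and
    \<open>?k - i\<close> is positive, so the added terms are zero.\<close>
  also have "\<dots> = (\<Sum>i\<le>d. ?g 0 i) + (\<Sum>j<d. \<Sum>i\<le>d. ?g (Suc j) i)"
    by (simp add: taylor_coeff_const)
  also have "\<dots> = (\<Sum>j\<le>d. \<Sum>i\<le>d. ?g j i)"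
    by (subst (2) sum.atMost_shift) simp
  also have "\<dots> = taylor_coeff (\<lambda>w. \<Sum>j\<le>d. poly (P j) w * f w ^ j) ?k z"
    using f deg by (subst taylor_coeff_poly_tuple) (auto intro!: sum.cong)
  finally show ?thesis .
qed

text \<open>By Cramer's rule the Bautin determinant times any coefficient of \<open>P j\<close>, \<open>j \<ge> 1\<close>, is a
  combination of high Taylor coefficients of the polynomial combination, so it would vanish to order
  above the Bautin multiplicity.\<close>
lemma poly_tuple_eq_0_if_taylor_coeffs_eq_0:
  fixes P :: "nat \<Rightarrow> complex poly"
  assumes f: "f analytic_on {0}" and deg: "\<And>j. j \<le> d \<Longrightarrow> Polynomial.degree (P j) \<le> d"
    and eta0: "taylor_coeff (bautin_det f d) \<eta> 0 \<noteq> 0"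
    and eta: "\<And>i. i < \<eta> \<Longrightarrow> taylor_coeff (bautin_det f d) i 0 = 0"
    and van: "\<And>k. k \<le> d\<^sup>2 + 2 * d + \<eta> \<Longrightarrow> taylor_coeff (\<lambda>w. \<Sum>j\<le>d. poly (P j) w * f w ^ j) k 0 = 0"
    and j: "j \<le> d"
  shows "P j = 0"
proof -
  define F where "F = (\<lambda>w. \<Sum>j\<le>d. poly (P j) w * f w ^ j)"
  have F: "F analytic_on {0}"
    unfolding F_def by (intro analytic_intros analytic_on_poly f)
  define N where "N = d\<^sup>2 + d"
  have Neq: "N = d * (d + 1)" by (simp add: N_def power2_eq_square)
  have pos: "P j = 0" if j: "1 \<le> j" "j \<le> d" for j
  proof (rule poly_eqI)
    fix i
    show "Polynomial.coeff (P j) i = Polynomial.coeff 0 i"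
    proof (cases "i \<le> d")
      case False
      then show ?thesis using deg[OF j(2)] by (simp add: coeff_eq_0)
    next
      case True
      \<comment> \<open>The column of the pair (j, i); the shift \<open>j - 1\<close> reflects that
        the columns start at \<open>j = 1\<close>.\<close>
      define s where "s = (j - 1) * (d + 1) + i"
      have sdiv: "s div (d + 1) + 1 = j" "s mod (d + 1) = i"
        unfolding s_def using True j by (simp_all add: div_mult_self3 del: add_Suc_right)
      have "s < (j - 1) * (d + 1) + (d + 1)" unfolding s_def using True by simp
      also have "\<dots> = j * (d + 1)" using j by (cases j) simp_all
      also have "\<dots> \<le> d * (d + 1)" using j by (intro mult_right_mono) auto
      finally have s: "s < N" unfolding Neq .
      \<comment> \<open>Cramer's identity is needed on a whole neighbourhood of 0, because its
        Taylor coefficient of index \<open>\<eta>\<close> is compared next.\<close>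
      obtain A where A: "open A" "0 \<in> A" "f analytic_on A"
        using f by (meson analytic_at analytic_on_open)
      have "\<forall>\<^sub>F z in nhds 0. bautin_det f d z * taylor_coeff (poly (P j)) i z =
           (\<Sum>r<N. cofactor (bautin_matrix f d z) r s * taylor_coeff F (d + 1 + r) z)"
      proof (rule eventually_mono[OF eventually_nhds_in_open[OF A(1,2)]])
        fix z assume "z \<in> A"
        then have fz: "f analytic_on {z}" using A(3) analytic_on_subset by blast
        have "bautin_det f d z * taylor_coeff (poly (P (s div (d+1) + 1))) (s mod (d+1)) z =
           (\<Sum>r<N. cofactor (bautin_matrix f d z) r s * (\<Sum>c<N. bautin_matrix f d z $$ (r,c) *
            taylor_coeff (poly (P (c div (d+1) + 1))) (c mod (d+1)) z))"
          unfolding bautin_det_def N_def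
          by (rule det_mult_eq_cofactor_sum[OF bautin_matrix_carrier s[unfolded N_def]])
        also have "\<dots> = (\<Sum>r<N. cofactor (bautin_matrix f d z) r s * taylor_coeff F (d + 1 + r) z)"
          unfolding F_def N_def
          by (rule sum.cong[OF refl], subst bautin_matrix_mult) (use fz deg in auto)
        finally show "bautin_det f d z * taylor_coeff (poly (P j)) i z =
           (\<Sum>r<N. cofactor (bautin_matrix f d z) r s * taylor_coeff F (d + 1 + r) z)"
          unfolding sdiv .
      qed
      then have "taylor_coeff (\<lambda>z. bautin_det f d z * taylor_coeff (poly (P j)) i z) \<eta> 0 =
          taylor_coeff (\<lambda>z. \<Sum>r<N. cofactor (bautin_matrix f d z) r s * taylor_coeff F (d + 1 + r) z) \<eta> 0"
        by (rule taylor_coeff_cong_ev)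
      also have "\<dots> = (\<Sum>r<N. \<Sum>l\<le>\<eta>. taylor_coeff (\<lambda>z. cofactor (bautin_matrix f d z) r s) l 0 *
           taylor_coeff (taylor_coeff F (d + 1 + r)) (\<eta> - l) 0)"
        by (subst taylor_coeff_sum)
           (use s in \<open>auto simp: N_def intro!: sum.cong taylor_coeff_mult analytic_on_mult
             bautin_cofactor_analytic analytic_on_taylor_coeff f F\<close>)
      \<comment> \<open>Since \<open>r < d^2 + d\<close>, the index
        \<open>(\<eta> - l) + (d + 1 + r)\<close> is at most \<open>d^2 + 2 d + \<eta>\<close>,
        exactly the range in which \<open>F\<close> is assumed to vanish.\<close>
      also have "\<dots> = 0"
      proof (intro sum.neutral ballI mult_eq_0_iff[THEN iffD2] disjI2)
        fix r l assume "r \<in> {..<N}"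
        then show "taylor_coeff (taylor_coeff F (d + 1 + r)) (\<eta> - l) 0 = 0"
          by (intro taylor_coeff_of_taylor_coeff_eq_0[OF F])
             (auto simp: N_def F_def intro!: van)
      qed
      also have "taylor_coeff (\<lambda>z. bautin_det f d z * taylor_coeff (poly (P j)) i z) \<eta> 0 =
         (\<Sum>l\<le>\<eta>. taylor_coeff (bautin_det f d) l 0 * taylor_coeff (taylor_coeff (poly (P j)) i) (\<eta> - l) 0)"
        by (intro taylor_coeff_mult bautin_det_analytic f analytic_on_taylor_coeff analytic_on_poly)
      \<comment> \<open>Only the leading coefficient of the determinant survives; it multiplies the
        value at 0 of \<open>taylor_coeff (poly (P j)) i\<close>, which is the coefficient
        sought.\<close>
      also have "\<dots> = (\<Sum>l\<in>{\<eta>}. taylor_coeff (bautin_det f d) l 0 *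
           taylor_coeff (taylor_coeff (poly (P j)) i) (\<eta> - l) 0)"
        by (rule sum.mono_neutral_right) (auto simp: eta)
      also have "\<dots> = taylor_coeff (bautin_det f d) \<eta> 0 * Polynomial.coeff (P j) i"
        by (simp add: taylor_coeff_def[of _ 0] flip: taylor_coeff_poly_0)
      finally show ?thesis using eta0 by simp
    qed
  qed
  show ?thesis
  proof (cases "j = 0")
    case True
    have "F = poly (P 0)"
      unfolding F_def by (simp add: fun_eq_iff sum.atMost_shift pos)
    then have "Polynomial.coeff (P 0) k = 0" if "k \<le> d" for k
      using van[of k] that by (simp add: F_def taylor_coeff_poly_0)
    moreover have "Polynomial.coeff (P 0) k = 0" if "k > d" for k
      using deg[of 0] that by (simp add: coeff_eq_0)
    ultimately show ?thesis using True by (intro poly_eqI) (metis coeff_0 not_le)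
  qed (use j pos in auto)
qed

subsection \<open>Zeros in a disc and Taylor coefficients\<close>

text \<open>Induction on \<open>Z\<close>: the factors already removed do not vanish at the new
  point \<open>a\<close>, so the quotient \<open>H\<close> has the same order there as
  \<open>F\<close>. The point \<open>w0\<close> and connectedness make this order finite.\<close>

lemma holomorphic_factor_zorder_prod:
  assumes F: "F holomorphic_on S" "open S" "connected S" "w0 \<in> S" "F w0 \<noteq> 0"
    and Z: "finite Z" "Z \<subseteq> S"
  shows "\<exists>H. H holomorphic_on S \<and> (\<forall>z\<in>S. F z = H z * (\<Prod>a\<in>Z. (z - a) ^ nat (zorder F a)))"
  using Z
proof (induction Z)
  case empty
  then show ?case using F(1) by auto
next
  case (insert a Z)
  define Q where "Q = (\<lambda>z. \<Prod>b\<in>Z. (z - b) ^ nat (zorder F b))"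
  obtain H where H: "H holomorphic_on S" and FH: "\<And>z. z \<in> S \<Longrightarrow> F z = H z * Q z"
    using insert unfolding Q_def by auto
  have a: "a \<in> S" using insert by auto
  have "\<forall>\<^sub>F z in at a. F z \<noteq> 0 \<and> z \<in> S"
    using non_zero_neighbour_alt[OF F(1-3) a F(4,5)] .
  then have nz: "\<forall>\<^sub>F z in at a. H z * Q z \<noteq> 0"
    by eventually_elim (use FH in auto)
  have Han: "H analytic_on {a}" using H F(2) a analytic_at by blast
  have Qan: "Q analytic_on {a}" unfolding Q_def by (intro analytic_intros)
  have Qa: "Q a \<noteq> 0" unfolding Q_def using insert.hyps by auto
  have "zorder F a = zorder (\<lambda>z. H z * Q z) a"
  proof (rule zorder_cong)
    show "\<forall>\<^sub>F z in at a. F z = H z * Q z"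
      using eventually_at_in_open'[OF F(2) a] by eventually_elim (rule FH)
  qed simp
  also have "\<dots> = zorder H a"
    using zorder_times_analytic[OF Han Qan nz] zorder_eq_0I[OF Qan Qa] by simp
  finally have zo: "zorder F a = zorder H a" .
  define n where "n = nat (zorder H a)"
  have "H w0 \<noteq> 0" using F FH by force
  then obtain r where r: "r > 0" "cball a r \<subseteq> S" "zor_poly H a holomorphic_on cball a r"
    and Hr: "\<And>w. w \<in> cball a r \<Longrightarrow> H w = zor_poly H a w * (w - a) ^ n"
    unfolding n_def using zorder_exist_zero[OF H F(2,3) a] F(4) by blast
  \<comment> \<open>\<open>zor_poly\<close> fills the removable singularity at \<open>a\<close>. The
    two formulas agree on the punctured ball, so \<open>H'\<close> is holomorphic on both open
    pieces and hence on their union.\<close>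
  define H' where "H' = (\<lambda>w. if w \<in> ball a r then zor_poly H a w else H w / (w - a) ^ n)"
  have "H' holomorphic_on ball a r"
  proof (rule holomorphic_transform)
    show "zor_poly H a holomorphic_on ball a r"
      using r(3) holomorphic_on_subset ball_subset_cball by blast
  qed (simp add: H'_def)
  moreover have "H' holomorphic_on S - {a}"
  proof (rule holomorphic_transform)
    show "(\<lambda>w. H w / (w - a) ^ n) holomorphic_on S - {a}"
      by (intro holomorphic_intros holomorphic_on_subset[OF H]) auto
    show "H w / (w - a) ^ n = H' w" if "w \<in> S - {a}" for w
      using Hr[of w] that by (auto simp: H'_def field_simps)
  qed
  ultimately have "H' holomorphic_on ball a r \<union> (S - {a})"
    using F(2) by (intro holomorphic_on_Un) (auto intro: open_Diff)
  moreover have "ball a r \<union> (S - {a}) = S"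
    using r a by (auto simp: subset_iff)
  ultimately have "H' holomorphic_on S" by simp
  moreover have "F z = H' z * (\<Prod>b\<in>insert a Z. (z - b) ^ nat (zorder F b))" if "z \<in> S" for z
  proof -
    have "H z = H' z * (z - a) ^ n"
      using Hr[of z] r(1) by (auto simp: H'_def)
    then show ?thesis
      using FH[OF that] insert.hyps by (simp add: zo n_def Q_def)
  qed
  ultimately show ?case by blast
qed

text \<open>Divide by the zeros: the quotient is at most \<open>M (4/3)^n\<close> on the unit circle, hence on the disc
  of radius 1/4, where the product of the zero factors is at most \<open>(1/2)^n\<close>.\<close>
lemma zero_count_taylor_coeff_bound:
  assumes F: "F analytic_on cball 0 1"
    and M: "\<And>z. norm z = 1 \<Longrightarrow> norm (F z) \<le> M"
    and k: "taylor_coeff F k 0 \<noteq> 0"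
  obtains n where "zero_count F (cball 0 (1/4)) = enat n"
    "norm (taylor_coeff F k 0) \<le> M * (2/3) ^ n * 4 ^ k"
proof -
  obtain S0 where S0: "open S0" "cball 0 1 \<subseteq> S0" "F holomorphic_on S0"
    using F analytic_on_holomorphic by blast
  \<comment> \<open>The component containing the unit disc is connected, as isolation of zeros and
    the factorization require.\<close>
  define S where "S = connected_component_set S0 0"
  have S: "open S" "connected S" "F holomorphic_on S"
    unfolding S_def
    using S0 by (auto intro!: open_connected_component
        holomorphic_on_subset[OF S0(3)] connected_component_subset)
  have S: "open S" "connected S" "F holomorphic_on S" "cball 0 1 \<subseteq> S"
    using S connected_component_maximal[of 0 "cball 0 1" S0] S0(2) by (auto simp: S_def)
  have S0': "0 \<in> S" using S(4) by auto
  obtain w0 where w0: "w0 \<in> S" "F w0 \<noteq> 0"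
  proof (rule ccontr)
    assume "\<not> thesis"
    then have "\<forall>\<^sub>F z in nhds 0. F z = 0"
      using that by (intro eventually_mono[OF eventually_nhds_in_open[OF S(1) S0']]) blast
    then have "(deriv ^^ k) F 0 = (deriv ^^ k) (\<lambda>_. 0) 0"
      by (intro higher_deriv_cong_ev) auto
    then show False using k by (simp add: taylor_coeff_def)
  qed
  define Z where "Z = {z \<in> cball 0 (1/4). F z = 0}"
  have "cball 0 (1/4) \<subseteq> (cball 0 1 :: complex set)" by auto
  then have sub: "cball 0 (1/4) \<subseteq> S" using S(4) by blast
  have fin: "finite Z"
  proof (cases "F constant_on S")
    case True
    then have "Z = {}" unfolding Z_def constant_on_def using w0 sub by fastforce
    then show ?thesis by simp
  next
    case False
    then show ?thesis
      unfolding Z_def by (intro holomorphic_compact_finite_zeros[OF S(3,1,2)] sub) auto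
  qed
  define n where "n = (\<Sum>z\<in>Z. nat (zorder F z))"
  have zc: "zero_count F (cball 0 (1/4)) = enat n"
    using fin by (simp add: zero_count_def n_def Z_def)
  have "Z \<subseteq> S" using sub by (auto simp: Z_def)
  then obtain H where H: "H holomorphic_on S"
    and FH: "\<And>z. z \<in> S \<Longrightarrow> F z = H z * (\<Prod>a\<in>Z. (z - a) ^ nat (zorder F a))"
    using holomorphic_factor_zorder_prod[OF S(3,1,2) w0 fin] by blast
  have Za: "norm a \<le> 1/4" if "a \<in> Z" for a using that by (simp add: Z_def)
  have Hbound: "norm (H z) \<le> M * (4/3) ^ n" if "z \<in> cball 0 1" for z
  proof (rule maximum_modulus_frontier[of H "cball 0 1"])
    show "H holomorphic_on interior (cball 0 1)"
      using H S(4) by (meson holomorphic_on_subset interior_subset)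
    show "continuous_on (closure (cball 0 1)) H"
      using H S(4) by (metis closed_cball closure_closed holomorphic_on_imp_continuous_on holomorphic_on_subset)
    fix z :: complex assume "z \<in> frontier (cball 0 1)"
    then have z: "norm z = 1" by simp
    then have zS: "z \<in> S" using S(4) by auto
    \<comment> \<open>A zero of norm at most 1/4 has distance at least 3/4 from the unit
      circle.\<close>
    have "(3/4) ^ n = (\<Prod>a\<in>Z. (3/4 :: real) ^ nat (zorder F a))"
      unfolding n_def by (rule power_sum)
    also have "\<dots> \<le> (\<Prod>a\<in>Z. norm (z - a) ^ nat (zorder F a))"
    proof (intro prod_mono conjI power_mono)
      fix a assume "a \<in> Z"
      then show "3/4 \<le> norm (z - a)" using Za[of a] norm_triangle_ineq2[of z a] z by simp
    qed auto
    also have "\<dots> = norm (\<Prod>a\<in>Z. (z - a) ^ nat (zorder F a))"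
      by (simp add: norm_power flip: prod_norm)
    finally have "norm (H z) * (3/4) ^ n \<le> norm (F z)"
      unfolding FH[OF zS] norm_mult by (intro mult_left_mono) auto
    also have "\<dots> \<le> M" by (rule M[OF z])
    finally show "norm (H z) \<le> M * (4/3) ^ n"
      by (simp add: power_divide field_simps)
  qed (use that in auto)
  have Fbound: "norm (F z) \<le> M * (2/3) ^ n" if z: "norm z \<le> 1/4" for z
  proof -
    have "norm (\<Prod>a\<in>Z. (z - a) ^ nat (zorder F a)) = (\<Prod>a\<in>Z. norm (z - a) ^ nat (zorder F a))"
      by (simp add: norm_power flip: prod_norm)
    also have "\<dots> \<le> (\<Prod>a\<in>Z. (1/2 :: real) ^ nat (zorder F a))"
    proof (intro prod_mono conjI power_mono)
      fix a assume "a \<in> Z"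
      then show "norm (z - a) \<le> 1/2" using Za[of a] norm_triangle_ineq4[of z a] z by simp
    qed auto
    also have "\<dots> = (1/2) ^ n" unfolding n_def by (rule power_sum[symmetric])
    finally have Q: "norm (\<Prod>a\<in>Z. (z - a) ^ nat (zorder F a)) \<le> (1/2) ^ n" .
    have zS: "z \<in> S" using z sub by auto
    have "norm (F z) \<le> (M * (4/3) ^ n) * (1/2) ^ n"
      unfolding FH[OF zS] norm_mult
      using Hbound[of z] Q z norm_ge_zero[of "H z"]
      by (intro mult_mono) (auto intro: order_trans[OF norm_ge_zero])
    also have "\<dots> = M * (2/3) ^ n"
      by (simp add: mult.assoc flip: power_mult_distrib)
    finally show ?thesis .
  qed
  \<comment> \<open>Cauchy's estimate on the circle of radius 1/4, where the bound has gained the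
    factor \<open>(2/3)^n\<close>; the small radius costs \<open>4^k\<close>.\<close>
  have "norm ((deriv ^^ k) F 0) \<le> fact k * (M * (2/3) ^ n) / (1/4) ^ k"
  proof (rule Cauchy_inequality)
    show "F holomorphic_on ball 0 (1/4)"
      using S(3) sub by (meson ball_subset_cball holomorphic_on_subset)
    show "continuous_on (cball 0 (1/4)) F"
      using S(3) sub by (meson continuous_on_subset holomorphic_on_imp_continuous_on)
  qed (use Fbound in auto)
  then have "norm (taylor_coeff F k 0) \<le> M * (2/3) ^ n * 4 ^ k"
    by (simp add: taylor_coeff_def norm_divide field_simps power_divide)
  with zc show thesis by (rule that)
qed

subsection \<open>Zeros of polynomial combinations\<close>

text \<open>By the Cauchy product, a coefficient of the \<open>j\<close>-th power is a sum of
  products of \<open>j\<close> coefficients of \<open>f\<close> of index at most \<open>N\<close>,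
  and \<open>D\<close> clears each factor.\<close>

lemma taylor_coeff_power_in_Ints:
  assumes f: "f analytic_on {z}"
    and D: "\<And>k. k \<le> N \<Longrightarrow> D * taylor_coeff f k z \<in> \<int>"
    and k: "k \<le> N"
  shows "D ^ j * taylor_coeff (\<lambda>w. f w ^ j) k z \<in> \<int>"
  using k
proof (induction j arbitrary: k)
  case 0
  then show ?case by (simp add: taylor_coeff_const)
next
  case (Suc j)
  have "D ^ Suc j * taylor_coeff (\<lambda>w. f w ^ Suc j) k z =
      (\<Sum>i\<le>k. (D * taylor_coeff f i z) * (D ^ j * taylor_coeff (\<lambda>w. f w ^ j) (k - i) z))"
    unfolding power_Suc
    by (subst taylor_coeff_mult) (auto intro!: analytic_intros f simp: sum_distrib_left mult_ac)
  also have "\<dots> \<in> \<int>"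
    by (rule Ints_sum, rule Ints_mult) (use Suc D in auto)
  finally show ?case .
qed

text \<open>Cauchy's estimate on the unit circle. It supplies the entrywise bound 1 for
  \<open>injective_system_lower_bound\<close>.\<close>

lemma norm_taylor_coeff_power_le:
  assumes f: "f analytic_on cball 0 1" and "\<And>z. z \<in> cball 0 1 \<Longrightarrow> norm (f z) \<le> 1"
  shows "norm (taylor_coeff (\<lambda>w. f w ^ j) k 0) \<le> 1"
proof -
  have fj: "(\<lambda>w. f w ^ j) holomorphic_on cball 0 1"
    using f by (intro analytic_imp_holomorphic analytic_intros)
  have "norm ((deriv ^^ k) (\<lambda>w. f w ^ j) 0) \<le> fact k * 1 / 1 ^ k"
  proof (rule Cauchy_inequality)
    show "(\<lambda>w. f w ^ j) holomorphic_on ball 0 1"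
      using fj ball_subset_cball holomorphic_on_subset by blast
    show "norm (f x ^ j) \<le> 1" if "norm (0 - x) = 1" for x
      using assms(2)[of x] that by (simp add: norm_power power_le_one)
  qed (use fj holomorphic_on_imp_continuous_on in auto)
  then show ?thesis by (simp add: taylor_coeff_def norm_divide)
qed

lemma finite_has_maximizer:
  fixes f :: "'a \<Rightarrow> 'b :: linorder"
  assumes "finite A" "A \<noteq> {}"
  shows "\<exists>x\<in>A. \<forall>y\<in>A. f y \<le> f x"
proof -
  have "Max (f ` A) \<in> f ` A" using assms by (intro Max_in) auto
  then obtain x where "x \<in> A" "f x = Max (f ` A)" by auto
  then show ?thesis using assms(1) by (intro bexI[of _ x]) auto
qed

text \<open>The largest coefficient of the tuple is bounded by the largest Taylor coefficient of
  index up to \<open>N\<close>, which in turn is bounded by the largest coefficient times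
  \<open>(2/3)^n\<close>. Cancelling it bounds \<open>n\<close>; \<open>q\<close> counts the
  coefficients.\<close>

lemma poly_tuple_zero_count_bound:
  fixes P :: "nat \<Rightarrow> complex poly"
  assumes f: "f analytic_on cball 0 1" and f1: "\<And>z. z \<in> cball 0 1 \<Longrightarrow> norm (f z) \<le> 1"
    and eta0: "taylor_coeff (bautin_det f d) \<eta> 0 \<noteq> 0"
    and eta: "\<And>i. i < \<eta> \<Longrightarrow> taylor_coeff (bautin_det f d) i 0 = 0"
    and N: "N = d\<^sup>2 + 2 * d + \<eta>"
    and D: "D > 0" "\<And>k. k \<le> N \<Longrightarrow> of_int D * taylor_coeff f k 0 \<in> \<int>"
    and P: "P \<in> poly_tuples d"
  defines "q \<equiv> (d + 1)\<^sup>2"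
  obtains n where
    "zero_count (\<lambda>z. \<Sum>j\<le>d. poly (P j) z * f z ^ j) (cball 0 (1/4)) = enat n"
    "(3/2) ^ n \<le> (real_of_int D ^ d) ^ (2 * q) * (fact q * real (Suc N) ^ q) * real q * 4 ^ N"
proof -
  have qq: "q = (d + 1) * (d + 1)" by (simp add: q_def power2_eq_square)
  have deg: "Polynomial.degree (P j) \<le> d" if "j \<le> d" for j
    using P that by (auto simp: poly_tuples_def)
  have f0: "f analytic_on {0}" using f by (rule analytic_on_subset) auto
  \<comment> \<open>The matrix taking the coefficients of the tuple to the Taylor coefficients at 0.
    Unlike in the Bautin matrix, the blocks start at \<open>j = 0\<close>, since \<open>P 0\<close>
    is an unknown too.\<close>
  define a where "a = (\<lambda>k c. if c mod (d + 1) \<le> k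
    then taylor_coeff (\<lambda>w. f w ^ (c div (d + 1))) (k - c mod (d + 1)) 0 else 0)"
  have comb: "(\<Sum>c<q. a k c * Polynomial.coeff (P (c div (d + 1))) (c mod (d + 1))) =
      taylor_coeff (\<lambda>z. \<Sum>j\<le>d. poly (P j) z * f z ^ j) k 0"
    if "\<And>j. j \<le> d \<Longrightarrow> Polynomial.degree (P j) \<le> d" for k P
  proof -
    have "(\<Sum>c<q. a k c * Polynomial.coeff (P (c div (d + 1))) (c mod (d + 1))) =
       (\<Sum>j<d+1. \<Sum>i<d+1. (if i \<le> k then taylor_coeff (\<lambda>w. f w ^ j) (k - i) 0 else 0) *
          Polynomial.coeff (P j) i)"
      unfolding qq a_def by (rule sum_div_mod)
    also have "\<dots> = taylor_coeff (\<lambda>z. \<Sum>j\<le>d. poly (P j) z * f z ^ j) k 0"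
      using f0 that
      by (subst taylor_coeff_poly_tuple)
         (simp_all only: taylor_coeff_poly_0 Suc_eq_plus1[symmetric] lessThan_Suc_atMost)
    finally show ?thesis .
  qed
  define F where "F = (\<lambda>z. \<Sum>j\<le>d. poly (P j) z * f z ^ j)"
  have Fan: "F analytic_on cball 0 1"
    unfolding F_def by (intro analytic_intros analytic_on_poly f)
  define v where "v = (\<lambda>c. Polynomial.coeff (P (c div (d + 1))) (c mod (d + 1)))"
  have cq: "j * (d + 1) + i < q" if "j \<le> d" "i \<le> d" for i j
  proof -
    have "j * (d + 1) + i < j * (d + 1) + (d + 1)" using that by simp
    also have "\<dots> = (j + 1) * (d + 1)" by simp
    also have "\<dots> \<le> q" unfolding qq using that by (intro mult_right_mono) auto
    finally show ?thesis .
  qed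
  have vji: "v (j * (d + 1) + i) = Polynomial.coeff (P j) i" if "i \<le> d" for i j
    unfolding v_def using that by (simp add: div_mult_self3 del: add_Suc_right)
  have q0: "q > 0" by (simp add: q_def)
  obtain s where s: "s < q" and smax: "\<And>c. c < q \<Longrightarrow> norm (v c) \<le> norm (v s)"
    using finite_has_maximizer[of "{..<q}" "\<lambda>c. norm (v c)"] q0
    by auto
  obtain k where k: "k \<le> N"
    and kmax: "\<And>l. l \<le> N \<Longrightarrow> norm (taylor_coeff F l 0) \<le> norm (taylor_coeff F k 0)"
    using finite_has_maximizer[of "{..N}" "\<lambda>l. norm (taylor_coeff F l 0)"]
    by auto
  define C where "C = (real_of_int D ^ d) ^ (2 * q) * (fact q * real (Suc N) ^ q)"
  have "C > 0" using D(1) by (simp add: C_def)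
  have div_le: "c div (d + 1) \<le> d" if "c < q" for c
    using that unfolding qq by (metis Suc_eq_plus1 less_Suc_eq_le less_mult_imp_div_less)
  have Kle: "norm (v s) \<le> C * norm (taylor_coeff F k 0)"
    unfolding C_def
  proof (rule injective_system_lower_bound[where a = a])
    fix l c assume lc: "l < Suc N" "c < q"
    define j i where "j = c div (d + 1)" and "i = c mod (d + 1)"
    have "of_int D ^ j * taylor_coeff (\<lambda>w. f w ^ j) (l - i) 0 \<in> \<int>"
      by (rule taylor_coeff_power_in_Ints[OF f0 D(2)]) (use lc in auto)
    \<comment> \<open>Padding \<open>D^j\<close> to \<open>D^d\<close> gives one denominator for all
      columns.\<close>
    then have "of_int D ^ (d - j) * (of_int D ^ j * taylor_coeff (\<lambda>w. f w ^ j) (l - i) 0) \<in> \<int>"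
      by (rule Ints_mult[OF Ints_power[OF Ints_of_int]])
    also have "of_int D ^ (d - j) * (of_int D ^ j * taylor_coeff (\<lambda>w. f w ^ j) (l - i) 0) =
        of_real (real_of_int D ^ d) * taylor_coeff (\<lambda>w. f w ^ j) (l - i) 0"
      using div_le[OF lc(2)] by (simp add: j_def flip: power_add mult.assoc)
    finally show "of_real (real_of_int D ^ d) * a l c \<in> \<int>"
      by (simp add: a_def j_def i_def)
    show "norm (a l c) \<le> 1"
      unfolding a_def using norm_taylor_coeff_power_le[OF f f1] by simp
  next
    fix u assume u: "\<And>k. k < Suc N \<Longrightarrow> (\<Sum>s<q. a k s * u s) = 0"
    \<comment> \<open>A kernel vector is read as a polynomial tuple, so that the uniqueness lemma
      makes it zero.\<close>
    define U where "U = (\<lambda>j. \<Sum>i\<le>d. monom (u (j * (d + 1) + i)) i)"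
    have Udeg: "Polynomial.degree (U j) \<le> d" for j
      unfolding U_def by (intro degree_sum_le) (auto intro: order_trans[OF degree_monom_le])
    have Uc: "Polynomial.coeff (U j) i = (if i \<le> d then u (j * (d + 1) + i) else 0)" for i j
      by (simp add: U_def coeff_sum)
    have uU: "Polynomial.coeff (U (c div (d + 1))) (c mod (d + 1)) = u c" for c
    proof -
      have "c mod (d + 1) < d + 1" by simp
      then have "c mod (d + 1) \<le> d" by linarith
      then show ?thesis unfolding Uc by (simp only: div_mult_mod_eq if_True)
    qed
    have van: "taylor_coeff (\<lambda>z. \<Sum>j\<le>d. poly (U j) z * f z ^ j) k 0 = 0" if "k \<le> N" for k
      using comb[of U k] Udeg u[of k] that unfolding uU by simp
    have "U j = 0" if "j \<le> d" for j
      by (rule poly_tuple_eq_0_if_taylor_coeffs_eq_0[where f = f and d = d and \<eta> = \<eta>])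
         (use f0 Udeg eta0 eta that van in \<open>simp_all add: N\<close>)
    then show "\<forall>c<q. u c = 0"
      using uU div_le by (metis coeff_0)
  next
    fix l assume "l < Suc N"
    then show "norm (\<Sum>c<q. a l c * v c) \<le> norm (taylor_coeff F k 0)"
      using kmax[of l] comb[of P l] deg unfolding v_def F_def by (simp del: One_nat_def add_Suc_right)
  qed (use D s in auto)
  have K0: "norm (v s) > 0"
  proof -
    obtain j where j: "j \<le> d" "P j \<noteq> 0" using P by (auto simp: poly_tuples_def)
    have "v (j * (d + 1) + Polynomial.degree (P j)) \<noteq> 0"
      using vji[OF deg[OF j(1)], of j] j by simp
    then have "0 < norm (v (j * (d + 1) + Polynomial.degree (P j)))" by simp
    also have "\<dots> \<le> norm (v s)" by (intro smax cq deg j)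
    finally show ?thesis .
  qed
  with Kle have "taylor_coeff F k 0 \<noteq> 0" by auto
  \<comment> \<open>On the unit circle \<open>F\<close> is a sum of \<open>q\<close> terms,
    \<open>d + 1\<close> powers of \<open>f\<close> with \<open>d + 1\<close> coefficients each,
    none larger than \<open>norm (v s)\<close>.\<close>
  moreover have "norm (F z) \<le> real q * norm (v s)" if z: "norm z = 1" for z
  proof -
    have "norm (poly (P j) z * f z ^ j) \<le> real (d + 1) * norm (v s)" if j: "j \<le> d" for j
    proof -
      have "norm (poly (P j) z) \<le> (\<Sum>i\<le>Polynomial.degree (P j). norm (v s))"
        unfolding poly_altdef
      proof (intro sum_norm_le)
        fix i assume "i \<in> {..Polynomial.degree (P j)}"
        then have i: "i \<le> d" using deg[OF j] by simp
        show "norm (Polynomial.coeff (P j) i * z ^ i) \<le> norm (v s)"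
          using smax[OF cq[OF j i]] z by (simp only: vji[OF i] norm_mult norm_power) simp
      qed
      also have "\<dots> \<le> real (d + 1) * norm (v s)"
        using deg[OF j] by (simp add: mult_right_mono)
      finally have "norm (poly (P j) z) * norm (f z ^ j) \<le> real (d + 1) * norm (v s) * 1"
        using f1[of z] z by (intro mult_mono) (auto simp: norm_power power_le_one)
      then show ?thesis by (simp add: norm_mult)
    qed
    then have "norm (F z) \<le> (\<Sum>j\<le>d. real (d + 1) * norm (v s))"
      unfolding F_def by (intro sum_norm_le) auto
    also have "\<dots> = real q * norm (v s)" by (simp add: qq algebra_simps)
    finally show ?thesis .
  qed
  ultimately obtain n where n: "zero_count F (cball 0 (1/4)) = enat n"
    and le: "norm (taylor_coeff F k 0) \<le> real q * norm (v s) * (2/3) ^ n * 4 ^ k"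
    using zero_count_taylor_coeff_bound[OF Fan] by metis
  have "norm (v s) \<le> C * (real q * norm (v s) * (2/3) ^ n * 4 ^ k)"
    using Kle le \<open>C > 0\<close> by (meson mult_left_mono order_trans less_imp_le)
  also have "\<dots> \<le> C * (real q * norm (v s) * (2/3) ^ n * 4 ^ N)"
    using \<open>C > 0\<close> k by (intro mult_left_mono power_increasing) auto
  also have "\<dots> = norm (v s) * (C * real q * 4 ^ N * (2/3) ^ n)" by simp
  finally have "1 \<le> C * real q * 4 ^ N * (2/3) ^ n"
    using K0 by simp
  then have "(3/2) ^ n \<le> C * real q * 4 ^ N"
    by (simp add: power_divide field_simps)
  with n show thesis unfolding F_def C_def by (rule that)
qed

section \<open>Common denominators and exponential estimates\<close>

lemma poly_mono_nonneg_coeffs: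
  fixes S :: "real poly"
  assumes "\<And>i. i \<le> Polynomial.degree S \<Longrightarrow> Polynomial.coeff S i \<ge> 0" "0 \<le> x" "x \<le> y"
  shows "poly S x \<le> poly S y"
  unfolding poly_altdef by (intro sum_mono mult_left_mono power_mono) (use assms in auto)

lemma power_le_exp: "0 \<le> x \<Longrightarrow> x \<le> exp y \<Longrightarrow> x ^ n \<le> exp (real n * y)" for x y :: real
  by (metis exp_of_nat_mult power_mono)

lemma real_le_exp: "x \<le> exp x" for x :: real
  using exp_ge_add_one_self[of x] by linarith

text \<open>The plain product of the denominators has \<open>N\<close> factors, each at most the
  height. The height starts at index 1, so index 0 is covered by \<open>c 0 = 0\<close>.\<close>

lemma common_denominator:
  fixes m p :: "nat \<Rightarrow> int"
  assumes p: "\<And>k. p k > 0" and c: "\<And>k. c k = (of_int (m k) / of_int (p k) :: complex)"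
    and c0: "c 0 = 0" and h: "real_of_int (denom_height p N) \<le> exp y" and k: "k \<le> N"
  shows "of_int (\<Prod>k=1..N. p k) * c k \<in> \<int>"
    and "real_of_int (\<Prod>k=1..N. p k) \<le> exp (real N * y)"
proof -
  show "of_int (\<Prod>k=1..N. p k) * c k \<in> \<int>"
  proof (cases "k = 0")
    case False
    then have "(\<Prod>k=1..N. p k) = p k * (\<Prod>k\<in>{1..N}-{k}. p k)"
      using k by (intro prod.remove) auto
    then have "of_int (\<Prod>k=1..N. p k) * c k = of_int ((\<Prod>k\<in>{1..N}-{k}. p k) * m k)"
      using p[of k] by (simp add: c)
    then show ?thesis by (metis Ints_of_int)
  qed (simp add: c0)
  have "real_of_int (\<Prod>k=1..N. p k) \<le> (\<Prod>k=1..N. exp y)"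
    unfolding of_int_prod
  proof (intro prod_mono conjI)
    fix k assume "k \<in> {1..N}"
    then have "p k \<le> denom_height p N" unfolding denom_height_def by (intro Max_ge) auto
    with h show "real_of_int (p k) \<le> exp y" by linarith
    show "0 \<le> real_of_int (p k)" using p[of k] by simp
  qed
  then show "real_of_int (\<Prod>k=1..N. p k) \<le> exp (real N * y)"
    by (simp add: exp_of_nat_mult)
qed

text \<open>Each factor is absorbed separately, for instance by \<open>fact q \<le> q^q\<close> and
  \<open>x \<le> exp x\<close>. The exponent is polynomial in \<open>q\<close>, \<open>d\<close>,
  \<open>N\<close> and \<open>y\<close>, the shape needed for \<open>T\<close>.\<close>

lemma zero_count_bound_le_exp:
  assumes D: "1 \<le> D" "D \<le> exp (real N * y)"
  shows "(D ^ d) ^ (2 * q) * (fact q * real (Suc N) ^ q) * real q * 4 ^ N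
    \<le> exp (2 * real q * real d * real N * y + real q * real q + real q * real N + real q + 2 * real N)"
proof -
  have "(D ^ d) ^ (2 * q) \<le> exp (real (d * (2 * q)) * (real N * y))"
    unfolding power_mult[symmetric] using D by (intro power_le_exp) auto
  moreover have "(fact q :: real) \<le> exp (real q * real q)"
  proof -
    have "(fact q :: real) \<le> real q ^ q" using fact_le_power[of q, where 'a = real] by simp
    also have "\<dots> \<le> exp (real q * real q)" by (intro power_le_exp real_le_exp) auto
    finally show ?thesis .
  qed
  moreover have "real (Suc N) ^ q \<le> exp (real q * real N)"
    using exp_ge_add_one_self[of "real N"] by (intro power_le_exp) auto
  moreover have "(4 :: real) ^ N \<le> exp (real N * 2)"
  proof (rule power_le_exp)
    have "(4::real) = 2 * 2" by simp
    also have "\<dots> \<le> exp 1 * exp 1"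
      using exp_ge_add_one_self[of 1] by (intro mult_mono) auto
    also have "\<dots> = exp 2" by (simp flip: exp_add)
    finally show "(4::real) \<le> exp 2" .
  qed simp
  ultimately have "(D ^ d) ^ (2 * q) * (fact q * real (Suc N) ^ q) * real q * 4 ^ N \<le>
     exp (real (d * (2 * q)) * (real N * y)) * (exp (real q * real q) * exp (real q * real N)) *
     exp (real q) * exp (real N * 2)"
    using real_le_exp[of "real q"] D by (intro mult_mono mult_nonneg_nonneg) auto
  also have "\<dots> = exp (2 * real q * real d * real N * y + real q * real q + real q * real N + real q + 2 * real N)"
    by (simp add: algebra_simps flip: exp_add)
  finally show ?thesis .
qed

lemma power_three_halves_le_exp:
  assumes "(3/2) ^ n \<le> exp x"
  shows "real n \<le> 3 * x"
proof -
  \<comment> \<open>This is the reciprocal of \<open>1 - 1/3 \<le> exp (-1/3)\<close>, and the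
    source of the factor 3.\<close>
  have "exp (1/3 :: real) \<le> 3/2"
    using exp_ge_add_one_self[of "-1/3 :: real"] by (simp add: exp_minus field_simps)
  then have "exp (1/3 :: real) ^ n \<le> (3/2) ^ n" by (intro power_mono) auto
  also have "\<dots> \<le> exp x" by fact
  finally have "exp (real n / 3) \<le> exp x" by (simp flip: exp_of_nat_mult)
  then show ?thesis by simp
qed

theorem theorem3p3p4:
  fixes f :: "complex \<Rightarrow> complex" and m p :: "nat \<Rightarrow> int"
  assumes "f analytic_on cball 0 1"
    and "f 0 = 0"
    and "\<forall>z\<in>cball 0 1. norm (f z) \<le> 1"
    and "\<forall>d\<ge>1. \<not> (\<forall>\<^sub>F z in nhds 0. bautin_det f d z = 0)"
    and "\<forall>k. p k > 0 \<and> coprime (m k) (p k) \<and>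
              taylor_coeff f k 0 = of_int (m k) / of_int (p k)"
    and "\<exists>S :: real poly. (\<forall>i\<le>degree S. Polynomial.coeff S i > 0) \<and>
              (\<forall>l\<ge>1. real_of_int (denom_height p l) \<le> exp (poly S (real l)))"
    and "\<exists>R :: real poly. \<forall>d\<ge>1. real_of_int (bautin_multiplicity f d) \<le> poly R (real d)"
  shows "\<exists>T :: real poly. \<forall>d\<ge>1. ereal_of_enat (max_zeros f d) \<le> ereal (poly T (real d))"
proof -
  obtain S :: "real poly" where S: "\<And>i. i \<le> degree S \<Longrightarrow> Polynomial.coeff S i > 0"
    and h: "\<And>l. l \<ge> 1 \<Longrightarrow> real_of_int (denom_height p l) \<le> exp (poly S (real l))"
    using assms(6) by blast
  obtain R :: "real poly" where
    R: "\<And>d. d \<ge> 1 \<Longrightarrow> real_of_int (bautin_multiplicity f d) \<le> poly R (real d)"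
    using assms(7) by blast
  \<comment> \<open>\<open>X\<close> majorizes \<open>N\<close>, with \<open>R\<close> standing for
    the multiplicity, and \<open>Q\<close> evaluates to \<open>q\<close>. \<open>T\<close> is 3
    times the exponent of \<open>zero_count_bound_le_exp\<close>, with \<open>N\<close> replaced by
    \<open>X\<close> and \<open>y\<close> by \<open>S\<close> at \<open>X\<close>.\<close>
  define X where "X = [:0, 2, 1:] + R"
  define Q :: "real poly" where "Q = [:1, 1:]\<^sup>2"
  define T where "T = Polynomial.smult 3 (Polynomial.smult 2 Q * [:0, 1:] * X * pcompose S X
    + Q * Q + Q * X + Q + Polynomial.smult 2 X)"
  have f0: "f analytic_on {0}" using assms(1) by (rule analytic_on_subset) auto
  have "ereal_of_enat (max_zeros f d) \<le> ereal (poly T (real d))" if d: "d \<ge> 1" for d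
  proof -
    obtain \<eta> where eta: "zorder (bautin_det f d) 0 = int \<eta>"
      "taylor_coeff (bautin_det f d) \<eta> 0 \<noteq> 0"
      "\<And>i. i < \<eta> \<Longrightarrow> taylor_coeff (bautin_det f d) i 0 = 0"
      using zorder_taylor_coeff[OF bautin_det_analytic[OF f0]] assms(4) d by metis
    define N where "N = d\<^sup>2 + 2 * d + \<eta>"
    define q where "q = (d + 1)\<^sup>2"
    define D where "D = (\<Prod>k=1..N. p k)"
    have N1: "N \<ge> 1" using d by (simp add: N_def)
    have Qq: "poly Q (real d) = real q" by (simp add: Q_def q_def add.commute)
    have NX: "real N \<le> poly X (real d)"
      using R[OF d] eta(1)
      by (simp add: bautin_multiplicity_def X_def N_def power2_eq_square algebra_simps)
    \<comment> \<open>Positivity of the coefficients of \<open>S\<close> makes it monotone on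
      nonnegative reals, so \<open>N\<close> may be replaced by its majorant.\<close>
    have SX: "poly S (real N) \<le> poly S (poly X (real d))"
      by (rule poly_mono_nonneg_coeffs) (use S NX in \<open>auto intro: less_imp_le\<close>)
    have S0: "0 \<le> poly S (real N)"
      unfolding poly_altdef by (intro sum_nonneg mult_nonneg_nonneg) (use S in \<open>auto intro: less_imp_le\<close>)
    have Dpos: "D > 0" unfolding D_def using assms(5) by (intro prod_pos) auto
    have pos: "p k > 0" and coeff: "taylor_coeff f k 0 = of_int (m k) / of_int (p k)" for k
      using assms(5) by auto
    have c0: "taylor_coeff f 0 0 = 0" using assms(2) by (simp add: taylor_coeff_def)
    note den = common_denominator[OF pos coeff c0 h[OF N1], folded D_def]
    have count: "\<exists>n. zero_count (\<lambda>z. \<Sum>j\<le>d. poly (P j) z * f z ^ j) (cball 0 (1/4)) = enat n \<and>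
        real n \<le> poly T (real d)" if P: "P \<in> poly_tuples d" for P
    proof -
      obtain n where n: "zero_count (\<lambda>z. \<Sum>j\<le>d. poly (P j) z * f z ^ j) (cball 0 (1/4)) = enat n"
        and le: "(3/2) ^ n \<le> (real_of_int D ^ d) ^ (2 * q) * (fact q * real (Suc N) ^ q) * real q * 4 ^ N"
        using poly_tuple_zero_count_bound[OF assms(1) assms(3)[rule_format] eta(2,3) N_def Dpos den(1) P]
        unfolding q_def by blast
      note le
      also have "(real_of_int D ^ d) ^ (2 * q) * (fact q * real (Suc N) ^ q) * real q * 4 ^ N \<le>
        exp (2 * real q * real d * real N * poly S (real N) + real q * real q + real q * real N
          + real q + 2 * real N)"
        by (rule zero_count_bound_le_exp) (use den(2)[of 0] Dpos in auto)
      finally have "real n \<le> 3 * (2 * real q * real d * real N * poly S (real N) + real q * real q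
          + real q * real N + real q + 2 * real N)"
        by (rule power_three_halves_le_exp)
      also have "\<dots> \<le> 3 * (2 * real q * real d * poly X (real d) * poly S (poly X (real d))
          + real q * real q + real q * poly X (real d) + real q + 2 * poly X (real d))"
        using NX SX S0 by (intro mult_left_mono add_mono mult_mono mult_nonneg_nonneg) auto
      also have "\<dots> = poly T (real d)"
        unfolding T_def by (simp add: Qq poly_pcompose)
      finally show ?thesis using n by blast
    qed
    \<comment> \<open>The constant tuple 1 witnesses that some zero count lies below
      \<open>poly T (real d)\<close>. Nonnegativity is needed for rounding down to a natural number
      and back.\<close>
    have T0: "0 \<le> poly T (real d)"
      using count[of "\<lambda>_. 1"] by (force simp: poly_tuples_def)
    have "max_zeros f d \<le> enat (nat \<lfloor>poly T (real d)\<rfloor>)"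
      unfolding max_zeros_def
    proof (rule SUP_least)
      fix P assume "P \<in> poly_tuples d"
      from count[OF this] show "zero_count (\<lambda>z. \<Sum>j\<le>d. poly (P j) z * f z ^ j) (cball 0 (1/4))
          \<le> enat (nat \<lfloor>poly T (real d)\<rfloor>)"
        by (auto simp: le_nat_floor)
    qed
    then have "ereal_of_enat (max_zeros f d) \<le> ereal_of_enat (enat (nat \<lfloor>poly T (real d)\<rfloor>))"
      by (simp only: ereal_of_enat_le_iff)
    also have "\<dots> \<le> ereal (poly T (real d))"
      using T0 of_nat_floor[OF T0] by simp
    finally show ?thesis .
  qed
  then show ?thesis by blast
qed

end
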